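(* There is a $(P_2)$-closed, torsion free, vertex transitive group $H\le\operatorname{Aut}(T_4)$ acting on the $4$-regular tree $T_4$.
   Context: For a tree $T$ with vertex set $VT$ and graph distance $d$, put $B(v,n)=\{w\in VT \mid d(v,w)\le n\}$. For $G\le\operatorname{Aut}(T)$, the $(P_k)$-closure of $G$ is $G^{(P_k)}=\{h\in\operatorname{Aut}(T)\mid \forall v\in VT\ \exists g\in G:\ h|_{B(v,k)}=g|_{B(v,k)}\}$, and $G$ is called $(P_k)$-closed if $G^{(P_k)}=G$. A group is torsion free if it has no non-trivial elements of finite order; vertex transitive means acting transitively on the vertex set of the tree. *)

theory Defs
  imports "HOL-Algebra.Group_Action"
begin

text \<open>
  A simple graph is a vertex set \<open>V\<close> together with a symmetric irreflexive adjacency relation \<open>E\<close>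
  on \<open>V\<close>; every undirected edge appears in \<open>E\<close> as two ordered pairs. Graphs may be infinite.
\<close>

definition simple_graph :: "'a set \<Rightarrow> ('a \<times> 'a) set \<Rightarrow> bool" where
  "simple_graph V E \<longleftrightarrow> E \<subseteq> V \<times> V \<and> sym E \<and> irrefl E"

definition graph_connected :: "'a set \<Rightarrow> ('a \<times> 'a) set \<Rightarrow> bool" where
  "graph_connected V E \<longleftrightarrow> (\<forall>u\<in>V. \<forall>v\<in>V. (u, v) \<in> E\<^sup>*)"

definition is_cycle :: "('a \<times> 'a) set \<Rightarrow> 'a list \<Rightarrow> bool" where
  "is_cycle E c \<longleftrightarrow> length c \<ge> 3 \<and> distinct c \<and>
     (\<forall>i<length c. (c ! i, c ! (Suc i mod length c)) \<in> E)"

definition is_tree :: "'a set \<Rightarrow> ('a \<times> 'a) set \<Rightarrow> bool" where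
  "is_tree V E \<longleftrightarrow> simple_graph V E \<and> V \<noteq> {} \<and> graph_connected V E \<and> (\<nexists>c. is_cycle E c)"

definition regular_tree :: "nat \<Rightarrow> 'a set \<Rightarrow> ('a \<times> 'a) set \<Rightarrow> bool" where
  "regular_tree d V E \<longleftrightarrow> is_tree V E \<and> (\<forall>v\<in>V. finite (E `` {v}) \<and> card (E `` {v}) = d)"

text \<open>The length of a shortest walk; meaningful only if \<open>v\<close> is reachable from \<open>u\<close>.\<close>

definition graph_dist :: "('a \<times> 'a) set \<Rightarrow> 'a \<Rightarrow> 'a \<Rightarrow> nat" where
  "graph_dist E u v = (LEAST n. (u, v) \<in> E ^^ n)"

definition graph_ball :: "'a set \<Rightarrow> ('a \<times> 'a) set \<Rightarrow> 'a \<Rightarrow> nat \<Rightarrow> 'a set" where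
  "graph_ball V E v n = {w \<in> V. graph_dist E v w \<le> n}"

text \<open>
  As in \<^const>\<open>BijGroup\<close>, automorphisms are extensional functions on \<open>V\<close>, so that
  equality of automorphisms is equality of their values on \<open>V\<close>.
\<close>

definition graph_auts :: "'a set \<Rightarrow> ('a \<times> 'a) set \<Rightarrow> ('a \<Rightarrow> 'a) set" where
  "graph_auts V E = {h \<in> Bij V. \<forall>u\<in>V. \<forall>v\<in>V. (h u, h v) \<in> E \<longleftrightarrow> (u, v) \<in> E}"

definition aut_group :: "'a set \<Rightarrow> ('a \<times> 'a) set \<Rightarrow> ('a \<Rightarrow> 'a) monoid" where
  "aut_group V E = (BijGroup V)\<lparr>carrier := graph_auts V E\<rparr>"

definition P_closure ::
    "'a set \<Rightarrow> ('a \<times> 'a) set \<Rightarrow> nat \<Rightarrow> ('a \<Rightarrow> 'a) set \<Rightarrow> ('a \<Rightarrow> 'a) set" where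
  "P_closure V E k G =
     {h \<in> graph_auts V E. \<forall>v\<in>V. \<exists>g\<in>G. \<forall>w\<in>graph_ball V E v k. h w = g w}"

definition P_closed ::
    "'a set \<Rightarrow> ('a \<times> 'a) set \<Rightarrow> nat \<Rightarrow> ('a \<Rightarrow> 'a) set \<Rightarrow> bool" where
  "P_closed V E k G \<longleftrightarrow> P_closure V E k G = G"

definition torsion_free :: "('g, 'b) monoid_scheme \<Rightarrow> bool" where
  "torsion_free G \<longleftrightarrow>
     \<not> (\<exists>g\<in>carrier G. g \<noteq> \<one>\<^bsub>G\<^esub> \<and> (\<exists>n::nat. n > 0 \<and> g [^]\<^bsub>G\<^esub> n = \<one>\<^bsub>G\<^esub>))"

lemma subgroup_graph_auts: "subgroup (graph_auts V E) (BijGroup V)"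
proof (rule group.subgroupI[OF group_BijGroup])
  show "graph_auts V E \<subseteq> carrier (BijGroup V)"
    by (auto simp: graph_auts_def BijGroup_def)
  have "(\<lambda>x\<in>V. x) \<in> graph_auts V E"
    by (auto simp: graph_auts_def id_Bij)
  then show "graph_auts V E \<noteq> {}" by blast
next
  fix f assume f: "f \<in> graph_auts V E"
  then have fB: "f \<in> Bij V" by (simp add: graph_auts_def)
  have iv: "inv_into V f x \<in> V" "f (inv_into V f x) = x" if "x \<in> V" for x
    using fB that by (auto simp: Bij_def bij_betw_def inv_into_into f_inv_into_f)
  show "inv\<^bsub>BijGroup V\<^esub> f \<in> graph_auts V E"
    using f iv restrict_inv_into_Bij[OF fB]
    by (simp add: inv_BijGroup[OF fB] graph_auts_def) metis
next
  fix f g assume fg: "f \<in> graph_auts V E" "g \<in> graph_auts V E"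
  then have B: "f \<in> Bij V" "g \<in> Bij V" by (simp_all add: graph_auts_def)
  then have "g x \<in> V" if "x \<in> V" for x
    using that Bij_imp_funcset by blast
  then show "f \<otimes>\<^bsub>BijGroup V\<^esub> g \<in> graph_auts V E"
    using fg compose_Bij[OF B] by (simp add: BijGroup_def graph_auts_def B compose_eq)
qed

lemma group_aut_group: "group (aut_group V E)"
  unfolding aut_group_def
  by (rule subgroup.subgroup_is_group[OF subgroup_graph_auts group_BijGroup])

text \<open>
  Regular trees of every positive degree exist: take the words over \<open>d\<close> letters without equal
  consecutive letters, a word being adjacent to its one-letter extensions. (Any two
  \<open>d\<close>-regular trees are isomorphic, which is why one speaks of ``the'' \<open>d\<close>-regular tree.)
\<close>

definition word_verts :: "nat \<Rightarrow> nat list set" where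
  "word_verts d = {w. set w \<subseteq> {..<d} \<and> distinct_adj w}"

definition word_edges :: "nat \<Rightarrow> (nat list \<times> nat list) set" where
  "word_edges d = {(u, v). u \<in> word_verts d \<and> v \<in> word_verts d \<and>
     (\<exists>a. u = a # v \<or> v = a # u)}"

lemma word_tree_regular:
  assumes "d > 0"
  shows "regular_tree d (word_verts d) (word_edges d)"
proof -
  let ?V = "word_verts d" and ?E = "word_edges d"
  have sg: "simple_graph ?V ?E"
    by (auto simp: simple_graph_def word_edges_def sym_def irrefl_def)
  have ne: "[] \<in> ?V" by (simp add: word_verts_def)
  have root: "(w, []) \<in> ?E\<^sup>*" if "w \<in> ?V" for w
    using that
  proof (induction w)
    case (Cons a w)
    then have w: "w \<in> ?V"
      by (auto simp: word_verts_def dest: distinct_adj_ConsD)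
    then have "(a # w, w) \<in> ?E" using Cons.prems by (auto simp: word_edges_def)
    with Cons.IH[OF w] show ?case by (rule converse_rtrancl_into_rtrancl[rotated])
  qed simp
  have "sym (?E\<^sup>*)" using sg by (simp add: simple_graph_def sym_rtrancl)
  then have conn: "graph_connected ?V ?E"
    unfolding graph_connected_def by (meson root rtrancl_trans symD)
  have nocyc: "\<not> is_cycle ?E c" for c
  proof
    assume c: "is_cycle ?E c"
    let ?n = "length c"
    have n: "?n \<ge> 3" and dist: "distinct c"
      and step: "\<And>i. i < ?n \<Longrightarrow> (c ! i, c ! (Suc i mod ?n)) \<in> ?E"
      using c by (auto simp: is_cycle_def)
    define M where "M = Max ((\<lambda>i. length (c ! i)) ` {..<?n})"
    have "M \<in> (\<lambda>i. length (c ! i)) ` {..<?n}"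
      unfolding M_def by (rule Max_in) (use n in \<open>auto simp: lessThan_empty_iff\<close>)
    then obtain i where i: "i < ?n" "length (c ! i) = M" by auto
    have le: "length (c ! j) \<le> length (c ! i)" if "j < ?n" for j
      unfolding i(2) M_def using that by (intro Max_ge) auto
    define p where "p = (if i = 0 then ?n - 1 else i - 1)"
    define s where "s = Suc i mod ?n"
    have p: "p < ?n" "Suc p mod ?n = i" using i n by (auto simp: p_def)
    have s: "s < ?n" unfolding s_def using n by (intro mod_less_divisor) linarith
    have ps: "p \<noteq> s" using i n by (auto simp: p_def s_def mod_Suc split: if_splits)
    have tl: "v = tl (c ! i)"
      if "(c ! i, v) \<in> ?E \<or> (v, c ! i) \<in> ?E" "length v \<le> length (c ! i)" for v
      using that by (auto simp: word_edges_def)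
    have "c ! p = tl (c ! i)" using step[OF p(1)] p le[OF p(1)] by (intro tl) auto
    moreover have "c ! s = tl (c ! i)" using step[OF i(1)] le[OF s] by (intro tl) (auto simp: s_def)
    ultimately show False using nth_eq_iff_index_eq[OF dist p(1) s] ps by simp
  qed
  have deg: "finite (?E `` {v}) \<and> card (?E `` {v}) = d" if v: "v \<in> ?V" for v
  proof (cases v)
    case Nil
    have "?E `` {v} = (\<lambda>a. [a]) ` {..<d}"
      by (auto simp: Nil word_edges_def word_verts_def)
    then show ?thesis by (simp add: card_image inj_on_def)
  next
    case (Cons b w)
    have w: "w \<in> ?V" using v Cons by (auto simp: word_verts_def dest: distinct_adj_ConsD)
    have b: "b < d" using v Cons by (auto simp: word_verts_def)
    have eq: "?E `` {v} = insert w ((\<lambda>a. a # v) ` ({..<d} - {b}))"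
      using v w Cons by (auto simp: word_edges_def word_verts_def)
    have "w \<notin> (\<lambda>a. a # v) ` ({..<d} - {b})" using Cons by auto
    then show ?thesis unfolding eq using b assms
      by (simp add: card_image inj_on_def)
  qed
  show ?thesis
    using sg ne conn nocyc deg unfolding regular_tree_def is_tree_def by blast
qed

end

theory Submission
  imports Defs "HOL-Combinatorics.Transposition"
begin

text \<open>
  The free group of rank two, acting on its Cayley tree, already has the required properties.
  A 4-regular tree is given the Cayley labelling: the edges leaving each vertex are labelled
  bijectively by the two generators and their inverses, with inverse labels on opposite directed
  edges. Take for \<open>H\<close> the label-preserving automorphisms. Preserving labels is a
  condition on single edges, whence \<open>(P\<^sub>k)\<close>-closedness for all \<open>k \<ge> 1\<close>. Walking along reduced words
  identifies the tree with the words from any base vertex, whence transitivity. Finally, if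
  \<open>g v\<close> is reached from \<open>v\<close> by the reduced word \<open>w \<noteq> []\<close>, and \<open>v\<close> is chosen such that \<open>w\<close> is as
  short as possible, then \<open>w\<close> is cyclically reduced, so that \<open>w\<^sup>n\<close> is reduced and \<open>g\<^sup>n v \<noteq> v\<close>.
\<close>

section \<open>Non-backtracking walks\<close>

text \<open>Induction on the gap \<open>j - i\<close>. A repetition would be a loop for gap 1, a
  backtrack for gap 2, and a cycle for larger gaps, whose vertices are distinct because smaller gaps
  admit no repetition.\<close>

lemma nonbacktracking_walk_distinct:
  assumes acyclic: "\<nexists>c. is_cycle E c" and "irrefl E"
    and step: "\<And>i. i < n \<Longrightarrow> (x i, x (Suc i)) \<in> E"
    and nb: "\<And>i. Suc (Suc i) \<le> n \<Longrightarrow> x (Suc (Suc i)) \<noteq> x i"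
    and "i < j" "j \<le> n"
  shows "x i \<noteq> x j"
  using \<open>i < j\<close> \<open>j \<le> n\<close>
proof (induction "j - i" arbitrary: i j rule: less_induct)
  case less
  show ?case
  proof
    assume eq: "x i = x j"
    consider "j = Suc i" | "j = Suc (Suc i)" | "j - i \<ge> 3"
      using less.prems by linarith
    then show False
    proof cases
      case 1
      then show ?thesis
        using step[of i] eq less.prems \<open>irrefl E\<close> by (auto simp: irrefl_def)
    next
      case 2
      then show ?thesis using nb[of i] eq less.prems by auto
    next
      case 3
      \<comment> \<open>The index \<open>j\<close> is left out because \<open>x j = x i\<close>; the
        step from \<open>j - 1\<close> to \<open>j\<close> becomes the closing edge.\<close>
      let ?c = "map x [i..<j]"
      have "inj_on x {i..<j}"
      proof (rule linorder_inj_onI)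
        fix p q assume "p < q" "p \<in> {i..<j}" "q \<in> {i..<j}"
        then show "x p \<noteq> x q" using less.hyps[of q p] less.prems by auto
      qed auto
      then have "distinct ?c" by (simp add: distinct_map)
      moreover have "(?c ! k, ?c ! (Suc k mod length ?c)) \<in> E" if "k < length ?c" for k
      proof (cases "Suc k = j - i")
        case True
        then have "Suc (i + k) = j" using less.prems by linarith
        then show ?thesis using True step[of "i + k"] eq less.prems by auto
      next
        case False
        then show ?thesis using step[of "i + k"] that less.prems by auto
      qed
      ultimately have "is_cycle E ?c" using 3 by (simp add: is_cycle_def)
      then show False using acyclic by blast
    qed
  qed
qed

text \<open>In a walk of least length a backtrack could be cut out, saving two steps.\<close>

lemma shortest_walk_nonbacktracking:
  assumes "(u, v) \<in> R\<^sup>*"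
  obtains x n where "x 0 = u" "x n = v" "\<And>i. i < n \<Longrightarrow> (x i, x (Suc i)) \<in> R"
    "\<And>i. Suc (Suc i) \<le> n \<Longrightarrow> x (Suc (Suc i)) \<noteq> x i"
proof -
  define n where "n = (LEAST n. (u, v) \<in> R ^^ n)"
  have "(u, v) \<in> R ^^ n"
    unfolding n_def using assms by (auto simp: rtrancl_power intro: LeastI)
  then obtain x where x: "x 0 = u" "x n = v" "\<And>i. i < n \<Longrightarrow> (x i, x (Suc i)) \<in> R"
    by (auto simp: relpow_fun_conv)
  have "x (Suc (Suc i)) \<noteq> x i" if i: "Suc (Suc i) \<le> n" for i
  proof
    assume eq: "x (Suc (Suc i)) = x i"
    have "(u, x i) \<in> R ^^ i"
      unfolding relpow_fun_conv using x i by (intro exI[of _ x]) auto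
    moreover have "(x i, v) \<in> R ^^ (n - Suc (Suc i))"
      unfolding relpow_fun_conv
    proof (intro exI conjI allI impI)
      show "x (Suc (Suc i) + 0) = x i" using eq by simp
      show "x (Suc (Suc i) + (n - Suc (Suc i))) = v"
        using x(2) i by (simp only: le_add_diff_inverse)
      show "(x (Suc (Suc i) + k), x (Suc (Suc i) + Suc k)) \<in> R" if "k < n - Suc (Suc i)" for k
        using x(3)[of "Suc (Suc i) + k"] that by simp
    qed
    ultimately have "(u, v) \<in> R ^^ (i + (n - Suc (Suc i)))"
      by (auto simp: relpow_add)
    then have "n \<le> i + (n - Suc (Suc i))"
      unfolding n_def by (rule Least_le)
    then show False using i by linarith
  qed
  then show thesis using that x by blast
qed

section \<open>Reduced words\<close>

text \<open>Words are read from right to left, so that the head of the list is the last letter.\<close>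

datatype letter = A | B | A_inv | B_inv

fun inv_letter :: "letter \<Rightarrow> letter" where
  "inv_letter A = A_inv"
| "inv_letter B = B_inv"
| "inv_letter A_inv = A"
| "inv_letter B_inv = B"

lemma inv_letter_inv_letter [simp]: "inv_letter (inv_letter a) = a"
  by (cases a) auto

lemma inv_letter_neq [simp]: "inv_letter a \<noteq> a" "a \<noteq> inv_letter a"
  by (cases a; simp)+

lemma UNIV_letter: "(UNIV :: letter set) = {A, B, A_inv, B_inv}"
proof -
  have "a \<in> {A, B, A_inv, B_inv}" for a by (cases a) auto
  then show ?thesis by blast
qed

definition reduced :: "letter list \<Rightarrow> bool" where
  "reduced = successively (\<lambda>a b. a \<noteq> inv_letter b)"

text \<open>Right multiplication by a generator or its inverse in the free group, on reduced normal
  forms. Since the head is the last letter, cancellation happens only there.\<close>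

fun append_letter :: "letter list \<Rightarrow> letter \<Rightarrow> letter list" where
  "append_letter [] a = [a]"
| "append_letter (b # w) a = (if a = inv_letter b then w else a # b # w)"

lemma reduced_Nil [simp]: "reduced []"
  by (simp add: reduced_def)

lemma reduced_ConsD: "reduced (a # w) \<Longrightarrow> reduced w"
  by (cases w) (auto simp: reduced_def)

lemma append_letter_reduced: "reduced (a # w) \<Longrightarrow> append_letter w a = a # w"
  by (cases w) (auto simp: reduced_def)

lemma reduced_append_letter: "reduced w \<Longrightarrow> reduced (append_letter w a)"
  by (cases w) (auto simp: reduced_def successively_Cons)

text \<open>Reducedness matters if \<open>a\<close> cancels the head of \<open>w\<close>: the
  inverse letter must then be put back and not cancel once more.\<close>

lemma append_letter_cancel: "reduced w \<Longrightarrow> append_letter (append_letter w a) (inv_letter a) = w"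
  by (cases w rule: remdups_adj.cases) (auto simp: reduced_def)

text \<open>A reduced \<open>a # w\<close> equals \<open>append_letter w a\<close>, so reduced words
  can be built along edges of the Cayley tree.\<close>

lemma reduced_induct [consumes 1, case_names Nil append_letter]:
  assumes "reduced w" and "P []"
    and "\<And>w a. reduced w \<Longrightarrow> P w \<Longrightarrow> P (append_letter w a)"
  shows "P w"
  using \<open>reduced w\<close>
proof (induction w)
  case (Cons a w)
  then show ?case
    using assms(3)[of w a] reduced_ConsD append_letter_reduced by metis
qed (simp add: assms(2))

text \<open>New adjacent letters arise only where two copies of \<open>w\<close> meet, namely
  \<open>last w\<close> next to \<open>hd w\<close>.\<close>

lemma reduced_concat_replicate:
  assumes "reduced w" "w \<noteq> []" "last w \<noteq> inv_letter (hd w)"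
  shows "reduced (concat (replicate n w))"
proof (induction n)
  case (Suc n)
  have "hd (concat (replicate n w)) = hd w" if "n \<noteq> 0"
    using that assms(2) by (cases n) auto
  then show ?case
    using Suc assms by (cases "n = 0") (auto simp: reduced_def successively_append_iff)
qed simp

text \<open>A local isomorphism from the Cayley tree to a tree is an isomorphism: a non-backtracking walk
  in the Cayley tree is mapped to a non-backtracking walk, which cannot be closed.\<close>

lemma bij_betw_reduced_tree:
  assumes tree: "is_tree V E" and root: "f [] \<in> V"
    and local: "\<And>w. reduced w \<Longrightarrow> bij_betw (\<lambda>a. f (append_letter w a)) UNIV (E `` {f w})"
  shows "bij_betw f {w. reduced w} V"
proof -
  have E: "E \<subseteq> V \<times> V" "irrefl E" "\<nexists>c. is_cycle E c" "graph_connected V E"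
    using tree by (auto simp: is_tree_def simple_graph_def)
  \<comment> \<open>The edges of the Cayley tree; appending the inverse letter traverses an edge
    backwards.\<close>
  define R where "R = {(w, append_letter w a) | w a. reduced w}"
  have symR: "sym R"
    unfolding sym_def R_def using append_letter_cancel reduced_append_letter
    by (auto, metis)
  have fE: "(f w, f w') \<in> E" if ww': "(w, w') \<in> R" for w w'
  proof -
    obtain a where "reduced w" "w' = append_letter w a" using ww' by (auto simp: R_def)
    then show ?thesis using bij_betw_apply[OF local, of w a] by simp
  qed
  have root_R: "([], w) \<in> R\<^sup>*" if "reduced w" for w
    using that
  proof (induction rule: reduced_induct)
    case (append_letter w a)
    then have "(w, append_letter w a) \<in> R" by (auto simp: R_def)
    with append_letter show ?case by (meson rtrancl.rtrancl_into_rtrancl)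
  qed simp
  have "inj_on f {w. reduced w}"
  proof (rule inj_onI)
    fix w w' assume w: "w \<in> {w. reduced w}" "w' \<in> {w. reduced w}" and eq: "f w = f w'"
    have "(w, []) \<in> R\<^sup>*" "([], w') \<in> R\<^sup>*"
      using root_R w symR by (auto intro: symD[OF sym_rtrancl])
    then have "(w, w') \<in> R\<^sup>*" by (rule rtrancl_trans)
    then obtain x n where x: "x 0 = w" "x n = w'" "\<And>i. i < n \<Longrightarrow> (x i, x (Suc i)) \<in> R"
      "\<And>i. Suc (Suc i) \<le> n \<Longrightarrow> x (Suc (Suc i)) \<noteq> x i"
      by (rule shortest_walk_nonbacktracking) blast
    have nb: "f (x (Suc (Suc i))) \<noteq> f (x i)" if i: "Suc (Suc i) \<le> n" for i
    proof
      assume eq: "f (x (Suc (Suc i))) = f (x i)"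
      \<comment> \<open>Both vertices are neighbours of \<open>x (Suc i)\<close>, and
        \<open>f\<close> is injective on the neighbours of a reduced word.\<close>
      have "(x (Suc i), x i) \<in> R" "(x (Suc i), x (Suc (Suc i))) \<in> R"
        using x(3)[of i] x(3)[of "Suc i"] i symR by (auto dest: symD)
      then obtain a b where ab: "x i = append_letter (x (Suc i)) a" "reduced (x (Suc i))"
        "x (Suc (Suc i)) = append_letter (x (Suc i)) b"
        by (auto simp: R_def)
      have "a = b"
        using local[OF ab(2)] eq ab by (auto simp: bij_betw_def dest: injD)
      then show False using ab x(4)[OF i] by simp
    qed
    have "n = 0"
    proof (rule ccontr)
      assume "n \<noteq> 0"
      then have "f (x 0) \<noteq> f (x n)"
        using nonbacktracking_walk_distinct[OF E(3,2), of n "\<lambda>i. f (x i)" 0 n] nb x(3) fE by blast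
      then show False using eq x by simp
    qed
    then show "w = w'" using x by simp
  qed
  moreover have "f ` {w. reduced w} = V"
  proof (intro equalityI subsetI)
    fix y assume "y \<in> f ` {w. reduced w}"
    then obtain w where "y = f w" "reduced w" by auto
    from this(2) have "f w \<in> V"
    proof (induction rule: reduced_induct)
      case (append_letter w a)
      then show ?case using fE E(1) by (auto simp: R_def)
    qed (fact root)
    then show "y \<in> V" using \<open>y = f w\<close> by simp
  next
    \<comment> \<open>Local surjectivity lifts a path starting at \<open>f []\<close> edge by
      edge.\<close>
    fix y assume "y \<in> V"
    then have "(f [], y) \<in> E\<^sup>*" using E(4) root by (auto simp: graph_connected_def)
    then show "y \<in> f ` {w. reduced w}"
    proof induction
      case (step y z)
      then obtain w where w: "reduced w" "y = f w" by auto
      then have "z \<in> range (\<lambda>a. f (append_letter w a))"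
        using step local by (auto simp: bij_betw_def)
      then show ?case using w reduced_append_letter by auto
    qed auto
  qed
  ultimately show ?thesis by (simp add: bij_betw_def)
qed

section \<open>Trees with a Cayley labelling\<close>

text \<open>\<open>step v a\<close> is the endpoint of the edge at \<open>v\<close> labelled
  \<open>a\<close>. The last assumption expresses that opposite edges carry inverse labels.\<close>

locale labelled_tree =
  fixes V :: "'a set" and E :: "('a \<times> 'a) set" and step :: "'a \<Rightarrow> letter \<Rightarrow> 'a"
  assumes tree: "is_tree V E"
    and step_bij: "v \<in> V \<Longrightarrow> bij_betw (step v) UNIV (E `` {v})"
    and step_inv_letter: "v \<in> V \<Longrightarrow> step (step v a) (inv_letter a) = v"
begin

lemma edge_iff: "v \<in> V \<Longrightarrow> (v, w) \<in> E \<longleftrightarrow> (\<exists>a. w = step v a)"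
  using step_bij[of v] by (auto simp: bij_betw_def)

lemma step_in: "v \<in> V \<Longrightarrow> step v a \<in> V"
  using edge_iff[of v "step v a"] tree by (auto simp: is_tree_def simple_graph_def)

fun walk :: "'a \<Rightarrow> letter list \<Rightarrow> 'a" where
  "walk v [] = v"
| "walk v (a # w) = step (walk v w) a"

lemma walk_in: "v \<in> V \<Longrightarrow> walk v w \<in> V"
  by (induction w) (auto simp: step_in)

lemma walk_append: "walk v (w @ w') = walk (walk v w') w"
  by (induction w) auto

text \<open>If the letter cancels, an edge is traversed to and fro.\<close>

lemma walk_append_letter: "v \<in> V \<Longrightarrow> walk v (append_letter w a) = step (walk v w) a"
  by (cases w) (auto simp: step_inv_letter walk_in)

lemma bij_betw_walk:
  assumes "v \<in> V"
  shows "bij_betw (walk v) {w. reduced w} V"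
  by (rule bij_betw_reduced_tree[OF tree])
    (use assms step_bij walk_in in \<open>auto simp: walk_append_letter\<close>)

text \<open>In the coordinates given by \<open>walk v\<close>, edges are right multiplications by
  letters, so these maps are the left translations of the free group.\<close>

definition label_auts :: "('a \<Rightarrow> 'a) set" where
  "label_auts = {h \<in> graph_auts V E. \<forall>v\<in>V. \<forall>a. h (step v a) = step (h v) a}"

lemma label_auts_in: "h \<in> label_auts \<Longrightarrow> v \<in> V \<Longrightarrow> h v \<in> V"
  using funcset_mem[OF Bij_imp_funcset] by (auto simp: label_auts_def graph_auts_def)

lemma label_auts_walk: "h \<in> label_auts \<Longrightarrow> v \<in> V \<Longrightarrow> h (walk v w) = walk (h v) w"
  by (induction w) (auto simp: label_auts_def walk_in)

text \<open>Edges are exactly the steps, so commuting with \<open>step\<close> preserves adjacency;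
  injectivity of \<open>h\<close> makes it reflect adjacency too.\<close>

lemma label_autsI:
  assumes h: "h \<in> Bij V" and step: "\<And>v a. v \<in> V \<Longrightarrow> h (step v a) = step (h v) a"
  shows "h \<in> label_auts"
proof -
  have "(h u, h v) \<in> E \<longleftrightarrow> (u, v) \<in> E" if uv: "u \<in> V" "v \<in> V" for u v
  proof -
    have "inj_on h V" "h u \<in> V"
      using h uv Bij_imp_funcset by (auto simp: Bij_def bij_betw_def)
    then show ?thesis
      using uv by (auto simp: edge_iff step[symmetric] step_in dest: inj_onD)
  qed
  then show ?thesis using assms by (auto simp: label_auts_def graph_auts_def)
qed

lemma subgroup_label_auts: "subgroup label_auts (aut_group V E)"
proof -
  have sub: "label_auts \<subseteq> Bij V" by (auto simp: label_auts_def graph_auts_def)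
  have "subgroup label_auts (BijGroup V)"
  proof (rule group.subgroupI[OF group_BijGroup])
    show "label_auts \<subseteq> carrier (BijGroup V)" using sub by (simp add: BijGroup_def)
    have "(\<lambda>x\<in>V. x) \<in> label_auts" by (rule label_autsI) (auto simp: id_Bij step_in)
    then show "label_auts \<noteq> {}" by blast
  next
    fix f assume f: "f \<in> label_auts"
    then have fB: "f \<in> Bij V" using sub by blast
    have iv: "inv_into V f x \<in> V" "f (inv_into V f x) = x" if "x \<in> V" for x
      using fB that by (auto simp: Bij_def bij_betw_def inv_into_into f_inv_into_f)
    have "restrict (inv_into V f) V \<in> label_auts"
    proof (rule label_autsI[OF restrict_inv_into_Bij[OF fB]])
      fix v a assume v: "v \<in> V"
      have "f (step (inv_into V f v) a) = step v a"
        using f iv[OF v] by (simp add: label_auts_def)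
      then have "inv_into V f (step v a) = step (inv_into V f v) a"
        using fB iv[OF v] step_in by (metis Bij_def Int_iff bij_betw_def inv_into_f_f mem_Collect_eq)
      then show "restrict (inv_into V f) V (step v a) = step (restrict (inv_into V f) V v) a"
        using v step_in by simp
    qed
    then show "inv\<^bsub>BijGroup V\<^esub> f \<in> label_auts" by (simp add: inv_BijGroup[OF fB])
  next
    fix f g assume fg: "f \<in> label_auts" "g \<in> label_auts"
    then have B: "f \<in> Bij V" "g \<in> Bij V" using sub by auto
    have "compose V f g \<in> label_auts"
      using fg label_auts_in[OF fg(2)]
      by (intro label_autsI compose_Bij B) (auto simp: compose_eq step_in label_auts_def)
    then show "f \<otimes>\<^bsub>BijGroup V\<^esub> g \<in> label_auts" by (simp add: BijGroup_def B)
  qed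
  then show ?thesis
    unfolding aut_group_def
    by (rule group.subgroup_incl[OF group_BijGroup _ subgroup_graph_auts])
      (auto simp: label_auts_def)
qed

text \<open>The label condition at \<open>v\<close> involves only \<open>v\<close> and its
  neighbours, all of which lie in the ball of radius \<open>k\<close>.\<close>

lemma P_closed_label_auts:
  assumes "k \<ge> 1"
  shows "P_closed V E k label_auts"
proof -
  have "h \<in> label_auts" if h: "h \<in> P_closure V E k label_auts" for h
  proof (rule label_autsI)
    show "h \<in> Bij V" using h by (simp add: P_closure_def graph_auts_def)
    fix v a assume v: "v \<in> V"
    obtain g where g: "g \<in> label_auts" "\<And>w. w \<in> graph_ball V E v k \<Longrightarrow> h w = g w"
      using h v by (auto simp: P_closure_def)
    have "graph_dist E v v \<le> 0"
      unfolding graph_dist_def by (rule Least_le) simp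
    moreover have "graph_dist E v (step v a) \<le> 1"
      unfolding graph_dist_def by (rule Least_le) (use v edge_iff in auto)
    ultimately have "v \<in> graph_ball V E v k" "step v a \<in> graph_ball V E v k"
      using v step_in assms by (auto simp: graph_ball_def)
    then show "h (step v a) = step (h v) a"
      using g v by (simp add: label_auts_def)
  qed
  then show ?thesis
    unfolding P_closed_def by (auto simp: P_closure_def label_auts_def)
qed

lemma label_auts_transitive:
  assumes "u \<in> V" "v \<in> V"
  shows "\<exists>h\<in>label_auts. h u = v"
proof -
  let ?W = "{w. reduced w}"
  \<comment> \<open>Read off the word leading from \<open>u\<close> to \<open>x\<close>, then follow
    the same word from \<open>v\<close>.\<close>
  define h where "h = (\<lambda>x\<in>V. walk v (inv_into ?W (walk u) x))"
  have bij: "bij_betw (walk u) ?W V" "bij_betw (walk v) ?W V"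
    using assms bij_betw_walk by auto
  have h_walk: "h (walk u w) = walk v w" if "reduced w" for w
    using that bij(1) walk_in[OF assms(1)] by (auto simp: h_def bij_betw_def inv_into_f_f)
  have "h \<in> Bij V"
    using bij_betw_trans[OF bij_betw_inv_into[OF bij(1)] bij(2)]
    by (auto simp: h_def Bij_def comp_def)
  then have "h \<in> label_auts"
  proof (rule label_autsI)
    fix x a assume "x \<in> V"
    then obtain w where w: "reduced w" "x = walk u w" using bij(1) by (auto simp: bij_betw_def)
    then show "h (step x a) = step (h x) a"
      using h_walk[OF w(1)] h_walk[OF reduced_append_letter[OF w(1), of a]] assms
      by (simp add: walk_append_letter)
  qed
  moreover have "h u = v" using h_walk[of "[]"] by simp
  ultimately show ?thesis by blast
qed

lemma transitive_action_label_auts: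
  "transitive_action ((aut_group V E)\<lparr>carrier := label_auts\<rparr>) V (\<lambda>h. h)"
proof -
  let ?H = "(aut_group V E)\<lparr>carrier := label_auts\<rparr>"
  have "group ?H"
    using subgroup.subgroup_is_group[OF subgroup_label_auts group_aut_group] .
  moreover have "(\<lambda>h. h) \<in> hom ?H (BijGroup V)"
    by (auto simp: hom_def aut_group_def BijGroup_def label_auts_def graph_auts_def)
  ultimately have "group_action ?H V (\<lambda>h. h)"
    by (simp add: group_action_def group_hom_def group_hom_axioms_def group_BijGroup)
  then show ?thesis
    using label_auts_transitive by (simp add: transitive_action_def transitive_action_axioms_def)
qed

text \<open>Every vertex is the end of a walk from \<open>v\<close>, and label-preserving maps
  commute with walks.\<close>

lemma label_auts_free:
  assumes h: "h \<in> label_auts" and "v \<in> V" "h v = v"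
  shows "h = (\<lambda>x\<in>V. x)"
proof (rule extensionalityI)
  show "h \<in> extensional V"
    using h by (auto simp: label_auts_def graph_auts_def Bij_def)
  fix x assume "x \<in> V"
  then obtain w where "x = walk v w" using bij_betw_walk[OF \<open>v \<in> V\<close>] by (auto simp: bij_betw_def)
  then show "h x = (\<lambda>x\<in>V. x) x"
    using label_auts_walk[OF h \<open>v \<in> V\<close>] \<open>h v = v\<close> \<open>x \<in> V\<close> by simp
qed auto

lemma label_auts_cyclically_reduced:
  assumes h: "h \<in> label_auts" and ne: "h \<noteq> (\<lambda>x\<in>V. x)"
  obtains v w where "v \<in> V" "h v = walk v w" "reduced w" "w \<noteq> []" "last w \<noteq> inv_letter (hd w)"
proof -
  define P where "P = (\<lambda>(v, w). v \<in> V \<and> reduced w \<and> h v = walk v w)"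
  obtain v0 where v0: "v0 \<in> V" using tree by (auto simp: is_tree_def)
  then obtain w0 where "reduced w0" "h v0 = walk v0 w0"
    using bij_betw_walk[OF v0] label_auts_in[OF h v0] by (auto simp: bij_betw_def)
  with v0 have "P (v0, w0)" by (simp add: P_def)
  \<comment> \<open>The length is minimised over base vertices and words together, that is, over the
    conjugates of a free group element.\<close>
  from ex_has_least_nat[of P, OF this, of "length \<circ> snd"]
  obtain v w where vw: "v \<in> V" "reduced w" "h v = walk v w"
    and least: "\<And>v' w'. v' \<in> V \<Longrightarrow> reduced w' \<Longrightarrow> h v' = walk v' w' \<Longrightarrow> length w \<le> length w'"
    by (auto simp: P_def)
  have w: "w \<noteq> []" using label_auts_free[OF h vw(1)] vw(3) ne by auto
  have "last w \<noteq> inv_letter (hd w)"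
  proof
    assume cyc: "last w = inv_letter (hd w)"
    define a where "a = last w"
    obtain b u where "w = b # u" using w by (cases w) auto
    \<comment> \<open>A single letter would be its own inverse.\<close>
    moreover from this cyc have "u \<noteq> []" by auto
    then obtain u' c where "u = u' @ [c]" by (cases u rule: rev_cases) auto
    ultimately have w_eq: "w = inv_letter a # u' @ [a]" using cyc by (simp add: a_def)
    \<comment> \<open>Moving the base vertex along the first letter \<open>a\<close> conjugates the
      word, which cancels both of its ends.\<close>
    have "h (step v a) = step (walk v w) a"
      using h vw by (simp add: label_auts_def)
    also have "\<dots> = walk v (u' @ [a])"
      using step_inv_letter[OF walk_in[OF vw(1)], of "u' @ [a]" "inv_letter a"] by (simp add: w_eq)
    also have "\<dots> = walk (step v a) u'" by (simp add: walk_append)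
    finally have "h (step v a) = walk (step v a) u'" .
    moreover have "reduced u'"
      using reduced_ConsD[OF vw(2)[unfolded w_eq]] by (simp add: reduced_def successively_append_iff)
    ultimately have "length w \<le> length u'" using least step_in[OF vw(1)] by blast
    then show False by (simp add: w_eq)
  qed
  then show thesis using that vw w by blast
qed

text \<open>If \<open>g\<close> moves \<open>v\<close> along a cyclically reduced \<open>w\<close>,
  then its powers move \<open>v\<close> along powers of \<open>w\<close>, which are reduced and
  nonempty for positive exponents.\<close>

lemma torsion_free_label_auts: "torsion_free ((aut_group V E)\<lparr>carrier := label_auts\<rparr>)"
  unfolding torsion_free_def
proof (intro notI, elim bexE conjE exE)
  let ?H = "(aut_group V E)\<lparr>carrier := label_auts\<rparr>"
  interpret H: group ?H
    using subgroup.subgroup_is_group[OF subgroup_label_auts group_aut_group] .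
  fix g and n :: nat
  assume "g \<in> carrier ?H" and ne: "g \<noteq> \<one>\<^bsub>?H\<^esub>" and n: "0 < n" and tors: "g [^]\<^bsub>?H\<^esub> n = \<one>\<^bsub>?H\<^esub>"
  then have g: "g \<in> label_auts" by simp
  have one: "\<one>\<^bsub>?H\<^esub> = (\<lambda>x\<in>V. x)" by (simp add: aut_group_def BijGroup_def)
  obtain v w where vw: "v \<in> V" "g v = walk v w" "reduced w" "w \<noteq> []" "last w \<noteq> inv_letter (hd w)"
    using label_auts_cyclically_reduced[OF g] ne one by auto
  have pow: "(g [^]\<^bsub>?H\<^esub> m) v = walk v (concat (replicate m w))" for m :: nat
  proof (induction m)
    case 0
    then show ?case using vw by (simp add: one)
  next
    case (Suc m)
    have gm: "g [^]\<^bsub>?H\<^esub> m \<in> label_auts" using H.nat_pow_closed[of g m] g by simp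
    \<comment> \<open>Here \<open>g\<close> is applied first, so the power with exponent
      \<open>m\<close> can be moved past the walk along \<open>w\<close>.\<close>
    have "g [^]\<^bsub>?H\<^esub> Suc m = compose V (g [^]\<^bsub>?H\<^esub> m) g"
      using g gm by (simp add: aut_group_def BijGroup_def label_auts_def graph_auts_def)
    then have "(g [^]\<^bsub>?H\<^esub> Suc m) v = (g [^]\<^bsub>?H\<^esub> m) (walk v w)"
      using vw by (simp add: compose_eq)
    also have "\<dots> = walk v (w @ concat (replicate m w))"
      using label_auts_walk[OF gm vw(1)] Suc by (simp add: walk_append)
    finally show ?case by simp
  qed
  have "walk v (concat (replicate n w)) = walk v []"
    using pow[of n] vw tors by (simp add: one)
  then have "concat (replicate n w) = []"
    using bij_betw_walk[OF vw(1)] reduced_concat_replicate[OF vw(3-5), of n]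
    by (metis bij_betw_def inj_onD mem_Collect_eq reduced_Nil)
  then show False using vw(4) n by (cases n) auto
qed

end

section \<open>Existence of Cayley labellings\<close>

text \<open>The value at a word is chosen among the neighbours of the value at its predecessor, such that
  cancelling letters leads back.\<close>

fun tree_cover :: "('a \<times> 'a) set \<Rightarrow> 'a \<Rightarrow> letter list \<Rightarrow> 'a" where
  "tree_cover E r [] = r"
| "tree_cover E r [a] = (SOME f. bij_betw f UNIV (E `` {r})) a"
| "tree_cover E r (a # b # w) =
     (SOME f. bij_betw f UNIV (E `` {tree_cover E r (b # w)}) \<and> f (inv_letter b) = tree_cover E r w) a"

lemma ex_bij_betw_letters:
  assumes "finite S" "card S = 4"
  shows "\<exists>f :: letter \<Rightarrow> 'a. bij_betw f UNIV S"
  using assms finite_same_card_bij[of "UNIV :: letter set" S] by (simp add: UNIV_letter)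

text \<open>Precomposing with the transposition of \<open>a\<close> and the preimage of
  \<open>y\<close> corrects the value at \<open>a\<close>.\<close>

lemma ex_bij_betw_with_value:
  assumes f: "bij_betw f S T" and "a \<in> S" "y \<in> T"
  shows "\<exists>g. bij_betw g S T \<and> g a = y"
proof -
  obtain c where c: "c \<in> S" "f c = y" using f \<open>y \<in> T\<close> by (auto simp: bij_betw_def)
  have "bij_betw (transpose a c) S S"
    using c(1) \<open>a \<in> S\<close> by (intro bij_betwI[of _ _ _ "transpose a c"]) (auto simp: transpose_def)
  then have "bij_betw (f \<circ> transpose a c) S T" using f by (rule bij_betw_trans)
  moreover have "(f \<circ> transpose a c) a = y" using c by simp
  ultimately show ?thesis by blast
qed

text \<open>This justifies the choices in \<open>tree_cover\<close>: by induction the value at the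
  predecessor is a neighbour, so a bijection can be prescribed to return to it.\<close>

lemma bij_betw_tree_cover_neighbours:
  assumes reg: "regular_tree 4 V E" and "r \<in> V" and "reduced w"
  shows "tree_cover E r w \<in> V \<and>
    bij_betw (\<lambda>a. tree_cover E r (append_letter w a)) UNIV (E `` {tree_cover E r w})"
  using \<open>reduced w\<close>
proof (induction w)
  case Nil
  have "\<exists>f :: letter \<Rightarrow> 'a. bij_betw f UNIV (E `` {r})"
    using reg \<open>r \<in> V\<close> by (intro ex_bij_betw_letters) (auto simp: regular_tree_def)
  from someI_ex[OF this] show ?case using \<open>r \<in> V\<close> by simp
next
  case (Cons b w)
  let ?x = "tree_cover E r (b # w)" and ?y = "tree_cover E r w"
  have sg: "E \<subseteq> V \<times> V" "sym E"
    using reg by (auto simp: regular_tree_def is_tree_def simple_graph_def)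
  have "append_letter w b = b # w" using Cons.prems by (rule append_letter_reduced)
  moreover have "bij_betw (\<lambda>a. tree_cover E r (append_letter w a)) UNIV (E `` {?y})"
    using Cons reduced_ConsD by blast
  ultimately have "(?y, ?x) \<in> E"
    by (metis Image_singleton_iff UNIV_I bij_betw_apply)
  then have x: "?x \<in> V" "?y \<in> E `` {?x}" using sg by (auto dest: symD)
  define Q where "Q f \<longleftrightarrow> bij_betw f UNIV (E `` {?x}) \<and> f (inv_letter b) = ?y" for f
  obtain f0 :: "letter \<Rightarrow> 'a" where "bij_betw f0 UNIV (E `` {?x})"
    using ex_bij_betw_letters[of "E `` {?x}"] reg x(1) by (auto simp: regular_tree_def)
  from ex_bij_betw_with_value[OF this UNIV_I x(2)] have "\<exists>f. Q f"
    unfolding Q_def .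
  then have "Q (SOME f. Q f)" by (rule someI_ex)
  \<comment> \<open>The chosen bijection describes all four neighbours: the constraint in
    \<open>Q\<close> covers the cancelling letter, the recursion the other three.\<close>
  moreover have "(\<lambda>a. tree_cover E r (append_letter (b # w) a)) = (SOME f. Q f)"
  proof
    fix a
    show "tree_cover E r (append_letter (b # w) a) = (SOME f. Q f) a"
    proof (cases "a = inv_letter b")
      case True
      then show ?thesis using \<open>Q (SOME f. Q f)\<close> by (simp add: Q_def)
    next
      case False
      then show ?thesis by (simp add: Q_def[abs_def])
    qed
  qed
  ultimately show ?case using x(1) by (simp add: Q_def)
qed

text \<open>The bijection \<open>tree_cover\<close> carries the labelling over from the Cayley tree,
  where \<open>append_letter_cancel\<close> gives inverse labels on opposite edges.\<close>

lemma ex_labelled_tree: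
  assumes reg: "regular_tree 4 V E"
  shows "\<exists>step. labelled_tree V E step"
proof -
  have tree: "is_tree V E" using reg by (simp add: regular_tree_def)
  then obtain r where r: "r \<in> V" by (auto simp: is_tree_def)
  let ?f = "tree_cover E r" and ?W = "{w. reduced w}"
  define step where "step v a = ?f (append_letter (inv_into ?W ?f v) a)" for v a
  note nbh = bij_betw_tree_cover_neighbours[OF reg r]
  have bij: "bij_betw ?f ?W V"
    using nbh r by (intro bij_betw_reduced_tree[OF tree]) auto
  have step: "step (?f w) a = ?f (append_letter w a)" if "reduced w" for w a
    using that bij by (simp add: step_def bij_betw_def inv_into_f_f)
  have "labelled_tree V E step"
  proof
    show "is_tree V E" by (fact tree)
    fix v a assume "v \<in> V"
    then obtain w where w: "reduced w" "v = ?f w" using bij by (auto simp: bij_betw_def)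
    have "step v = (\<lambda>a. ?f (append_letter w a))" using step w by auto
    then show "bij_betw (step v) UNIV (E `` {v})" using nbh w by auto
    show "step (step v a) (inv_letter a) = v"
      using w by (simp add: step reduced_append_letter append_letter_cancel)
  qed
  then show ?thesis by blast
qed

theorem theorem3p8:
  fixes V :: "'a set" and E :: "('a \<times> 'a) set"
  assumes "regular_tree 4 V E"
  shows "\<exists>H. subgroup H (aut_group V E)
           \<and> P_closed V E 2 H
           \<and> torsion_free ((aut_group V E)\<lparr>carrier := H\<rparr>)
           \<and> transitive_action ((aut_group V E)\<lparr>carrier := H\<rparr>) V (\<lambda>h. h)"
proof -
  obtain step where "labelled_tree V E step" using ex_labelled_tree[OF assms] by blast
  then interpret labelled_tree V E step .
  show ?thesis
    using subgroup_label_auts P_closed_label_auts[of 2] torsion_free_label_auts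
      transitive_action_label_auts by auto
qed

end
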